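(* Consider the "identify exactly $m$ boxes" variant of the Test and Find problem with $1\le m\le k$ (see context) and reward $C>0$. (i) Let $\eta^*:\Sigma\to\mathcal H_m$ be any function such that for each $s\in\Sigma$ $$\eta^*(s)\in\underset{\eta\in\mathcal H_m}{\operatorname{argmax}}\ \sum_{\gamma\in\Gamma:\ \gamma_i=1\ \forall i\in\eta}\pi(\gamma)p(s|\gamma).$$ Then $\eta^*$ maximizes the expected reward $C\,P(T_i=1\ \forall i\in\delta(S))$ among all functions $\delta:\Sigma\to\mathcal H_m$, and its expected reward equals $$C\sum_{s\in\Sigma}\max_{\eta\in\mathcal H_m}\Big(\sum_{\gamma\in\Gamma:\ \gamma_i=1\ \forall i\in\eta}\pi(\gamma)p(s|\gamma)\Big).$$ (ii) Suppose in addition that $\pi$ is the uniform distribution on $\Gamma$ and that $a_i=a$, $b_i=b$ for all $i$, where $1/2\le a,b<1$ and at least one of $a\neq1/2$, $b\ne1/2$ holds. For $s\in\Sigma$ let $x=\sum_{i=1}^n(1-s_i)$. If $n-x\ge m$, then any set $\eta$ of $m$ indices $i$ with $s_i=1$ attains the maximum defining $\eta^*(s)$ in (i). If $n-x<m$, then any set $\eta$ consisting of all indices $i$ with $s_i=1$ together with any $m-n+x$ indices $i$ with $s_i=0$ attains this maximum.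
   Context: Let $1\le m\le k\le n$ be integers and $a_i,b_i\in[1/2,1]$ for $i=1,\dots,n$. Let $\Gamma=\{\gamma\in\{0,1\}^n:\sum_j\gamma_j=k\}$ (allocations of $k$ objects to $n$ boxes), $\Sigma=\{0,1\}^n$ (signals), and let $\mathcal H_m$ be the collection of all $m$-element subsets of $\{1,\dots,n\}$. $T=(T_1,\dots,T_n)$ is a $\Gamma$-valued random vector with arbitrary distribution $\pi$. $S=(S_1,\dots,S_n)\in\Sigma$ is the vector of test results: conditionally on $T=\gamma$, the $S_i$ are independent with $P(S_i=1|T=\gamma)=a_i$ if $\gamma_i=1$ and $P(S_i=0|T=\gamma)=b_i$ if $\gamma_i=0$. The conditional probability mass function is $$p(s|\gamma)=\prod_{i:\gamma_i=1}a_i^{s_i}(1-a_i)^{1-s_i}\prod_{i:\gamma_i=0}b_i^{1-s_i}(1-b_i)^{s_i}\qquad(0^0=1).$$ In this variant the decision maker observes $S$ and then tags exactly $m$ boxes, those with index in $\delta(S)\in\mathcal H_m$; she receives $C$ if all $m$ tagged boxes contain objects and $0$ otherwise. *)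

theory Defs
  imports "HOL-Probability.Probability"
begin

text \<open>Vectors in \<open>{0,1}\<^sup>n\<close> are extensional functions on the index set \<open>{1..n}\<close>
  with natural number values, so that they can be used directly as exponents.\<close>

definition signals :: "nat \<Rightarrow> (nat \<Rightarrow> nat) set" where
  "signals n = {1..n} \<rightarrow>\<^sub>E {0, 1}"

definition allocations :: "nat \<Rightarrow> nat \<Rightarrow> (nat \<Rightarrow> nat) set" where
  "allocations n k = {\<gamma> \<in> {1..n} \<rightarrow>\<^sub>E {0, 1}. (\<Sum>j=1..n. \<gamma> j) = k}"

definition box_sets :: "nat \<Rightarrow> nat \<Rightarrow> nat set set" where
  "box_sets n m = {\<eta>. \<eta> \<subseteq> {1..n} \<and> card \<eta> = m}"

definition signal_pmf ::
    "nat \<Rightarrow> (nat \<Rightarrow> real) \<Rightarrow> (nat \<Rightarrow> real) \<Rightarrow> (nat \<Rightarrow> nat) \<Rightarrow> (nat \<Rightarrow> nat) \<Rightarrow> real" where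
  "signal_pmf n a b s \<gamma> =
     (\<Prod>i\<in>{i\<in>{1..n}. \<gamma> i = 1}. a i ^ s i * (1 - a i) ^ (1 - s i)) *
     (\<Prod>i\<in>{i\<in>{1..n}. \<gamma> i = 0}. b i ^ (1 - s i) * (1 - b i) ^ s i)"

definition joint_weight ::
    "nat \<Rightarrow> nat \<Rightarrow> (nat \<Rightarrow> real) \<Rightarrow> (nat \<Rightarrow> real) \<Rightarrow> ((nat \<Rightarrow> nat) \<Rightarrow> real) \<Rightarrow>
     (nat \<Rightarrow> nat) \<Rightarrow> nat set \<Rightarrow> real" where
  "joint_weight n k a b \<pi> s \<eta> =
     (\<Sum>\<gamma>\<in>{\<gamma> \<in> allocations n k. \<forall>i\<in>\<eta>. \<gamma> i = 1}. \<pi> \<gamma> * signal_pmf n a b s \<gamma>)"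

text \<open>Conditioning on \<open>T = \<gamma>\<close> is only required to be meaningful for allocations of positive
  probability; \<open>uniform_measure M A\<close> is the conditional probability measure given \<open>A\<close>.\<close>

locale test_and_find = prob_space M
  for M :: "'w measure" +
  fixes n k :: nat
    and a b :: "nat \<Rightarrow> real"
    and \<pi> :: "(nat \<Rightarrow> nat) \<Rightarrow> real"
    and T S :: "'w \<Rightarrow> nat \<Rightarrow> nat"
  assumes T_measurable: "T \<in> M \<rightarrow>\<^sub>M count_space (allocations n k)"
    and S_measurable: "S \<in> M \<rightarrow>\<^sub>M count_space (signals n)"
    and T_distribution:
      "\<And>\<gamma>. \<gamma> \<in> allocations n k \<Longrightarrow> \<P>(\<omega> in M. T \<omega> = \<gamma>) = \<pi> \<gamma>"
    and S_cond_indep: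
      "\<And>\<gamma>. \<gamma> \<in> allocations n k \<Longrightarrow> \<pi> \<gamma> > 0 \<Longrightarrow>
        prob_space.indep_vars (uniform_measure M {\<omega> \<in> space M. T \<omega> = \<gamma>})
          (\<lambda>_. count_space {0, 1}) (\<lambda>i \<omega>. S \<omega> i) {1..n}"
    and true_positive:
      "\<And>\<gamma> i. \<gamma> \<in> allocations n k \<Longrightarrow> \<pi> \<gamma> > 0 \<Longrightarrow> i \<in> {1..n} \<Longrightarrow> \<gamma> i = 1 \<Longrightarrow>
        \<P>(\<omega> in M. S \<omega> i = 1 \<bar> T \<omega> = \<gamma>) = a i"
    and true_negative:
      "\<And>\<gamma> i. \<gamma> \<in> allocations n k \<Longrightarrow> \<pi> \<gamma> > 0 \<Longrightarrow> i \<in> {1..n} \<Longrightarrow> \<gamma> i = 0 \<Longrightarrow>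
        \<P>(\<omega> in M. S \<omega> i = 0 \<bar> T \<omega> = \<gamma>) = b i"

definition expected_reward ::
    "'w measure \<Rightarrow> ('w \<Rightarrow> nat \<Rightarrow> nat) \<Rightarrow> ('w \<Rightarrow> nat \<Rightarrow> nat) \<Rightarrow> real \<Rightarrow>
     ((nat \<Rightarrow> nat) \<Rightarrow> nat set) \<Rightarrow> real" where
  "expected_reward M T S C \<delta> =
     (\<integral>\<omega>. (if \<forall>i\<in>\<delta> (S \<omega>). T \<omega> i = 1 then C else 0) \<partial>M)"

end

theory Submission
  imports Defs
begin

text \<open>
  Part (i) is a pointwise optimization. Conditional independence of the test results gives
  \<open>P(S = s, T = \<gamma>) = \<pi>(\<gamma>) p(s|\<gamma>)\<close> (\<open>joint_prob_eq\<close>). Summing this over the signals \<open>s\<close> and the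
  allocations with objects in all boxes of \<open>\<delta>(s)\<close>, the success probability of a rule \<open>\<delta>\<close> becomes
  a sum over \<open>s\<close> of terms in which \<open>\<delta>\<close> enters only through its value at \<open>s\<close>
  (\<open>success_prob_eq\<close>). As \<open>\<delta>\<close> may be chosen independently at every \<open>s\<close>, maximizing each term
  maximizes the sum.

  Part (ii) is an exchange argument. Let \<open>\<eta>\<close> contain \<open>i\<close> but not \<open>j\<close>, where \<open>s i \<le> s j\<close>.
  Interchanging the contents of boxes \<open>i\<close> and \<open>j\<close> turns an allocation that is favourable for \<open>\<eta>\<close>
  only into one that is favourable for \<open>(\<eta> - {i}) \<union> {j}\<close> only. When the two boxes have
  the same error probabilities, its likelihood does not go down: it is unchanged if
  \<open>s i = s j\<close>, and otherwise a factor \<open>(1 - a) (1 - b)\<close> becomes \<open>a b\<close>, which is at least as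
  large because \<open>a, b \<ge> 1/2\<close>. Hence \<open>(\<eta> - {i}) \<union> {j}\<close> is at least as good as \<open>\<eta>\<close>
  (\<open>joint_weight_exchange\<close>). Both sets described in (ii) have the property that no box outside
  has a larger signal than a box inside, so finitely many such exchanges lead from any
  competitor to them (\<open>top_set_arg_max\<close>).
\<close>

section \<open>Signals and their likelihood\<close>

lemma finite_signals: "finite (signals n)"
  unfolding signals_def by (intro finite_PiE) auto

lemma finite_allocations: "finite (allocations n k)"
  by (rule finite_subset[OF _ finite_signals[of n]]) (auto simp: allocations_def signals_def)

lemma finite_box_sets: "finite (box_sets n m)"
  by (rule finite_subset[of _ "Pow {1..n}"]) (auto simp: box_sets_def)

lemma allocations_cases:
  assumes "\<gamma> \<in> allocations n k" "i \<in> {1..n}"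
  shows "\<gamma> i = 0 \<or> \<gamma> i = 1"
  using assms PiE_mem[of \<gamma> "{1..n}" "\<lambda>_. {0, 1}" i] by (simp add: allocations_def)

lemma signals_cases:
  assumes "s \<in> signals n" "i \<in> {1..n}"
  shows "s i = 0 \<or> s i = 1"
  using assms PiE_mem[of s "{1..n}" "\<lambda>_. {0, 1}" i] by (simp add: signals_def)

definition box_likelihood :: "real \<Rightarrow> real \<Rightarrow> nat \<Rightarrow> nat \<Rightarrow> real" where
  "box_likelihood \<alpha> \<beta> g t =
     (if g = 1 then \<alpha> ^ t * (1 - \<alpha>) ^ (1 - t) else \<beta> ^ (1 - t) * (1 - \<beta>) ^ t)"

text \<open>A single product over all boxes suits both independence, which yields one factor per box,
  and the exchange argument, which alters two factors and keeps the others.\<close>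

lemma signal_pmf_eq_prod:
  assumes "\<gamma> \<in> allocations n k"
  shows "signal_pmf n a b s \<gamma> = (\<Prod>i=1..n. box_likelihood (a i) (b i) (\<gamma> i) (s i))"
proof -
  have eq: "{1..n} = {i\<in>{1..n}. \<gamma> i = 1} \<union> {i\<in>{1..n}. \<gamma> i = 0}"
    using allocations_cases[OF assms] by blast
  show ?thesis
    unfolding signal_pmf_def
    by (subst (3) eq, subst prod.union_disjoint)
      (auto intro!: arg_cong2[where f = "(*)"] prod.cong simp: box_likelihood_def)
qed

section \<open>The optimal rule maximizes pointwise\<close>

context test_and_find
begin

lemma T_sets [measurable]: "{\<omega> \<in> space M. T \<omega> = \<gamma>} \<in> events"
proof -
  have "{\<omega> \<in> space M. T \<omega> = \<gamma>} = T -` ({\<gamma>} \<inter> allocations n k) \<inter> space M"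
    using measurable_space[OF T_measurable] by auto
  also have "\<dots> \<in> events"
    by (rule measurable_sets[OF T_measurable]) auto
  finally show ?thesis .
qed

lemma S_sets [measurable]: "{\<omega> \<in> space M. P (S \<omega>)} \<in> events"
proof -
  have "{\<omega> \<in> space M. P (S \<omega>)} = S -` ({s. P s} \<inter> signals n) \<inter> space M"
    using measurable_space[OF S_measurable] by auto
  also have "\<dots> \<in> events"
    by (rule measurable_sets[OF S_measurable]) auto
  finally show ?thesis .
qed

text \<open>The model prescribes only the probability of a correct test result; that of an incorrect one
  follows because a test result is always 0 or 1.\<close>

lemma cond_prob_signal_coordinate:
  assumes \<gamma>: "\<gamma> \<in> allocations n k" and pos: "\<pi> \<gamma> > 0"
    and s: "s \<in> signals n" and i: "i \<in> {1..n}"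
  shows "\<P>(\<omega> in M. S \<omega> i = s i \<bar> T \<omega> = \<gamma>) = box_likelihood (a i) (b i) (\<gamma> i) (s i)"
proof -
  have T: "\<P>(\<omega> in M. T \<omega> = \<gamma>) = \<pi> \<gamma>"
    using T_distribution[OF \<gamma>] .
  have "\<P>(\<omega> in M. T \<omega> = \<gamma>) =
      prob ({\<omega> \<in> space M. S \<omega> i = 0 \<and> T \<omega> = \<gamma>} \<union> {\<omega> \<in> space M. S \<omega> i = 1 \<and> T \<omega> = \<gamma>})"
    using measurable_space[OF S_measurable] signals_cases[OF _ i]
    by (intro arg_cong[where f = prob]) auto
  also have "\<dots> = \<P>(\<omega> in M. S \<omega> i = 0 \<and> T \<omega> = \<gamma>) + \<P>(\<omega> in M. S \<omega> i = 1 \<and> T \<omega> = \<gamma>)"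
    by (intro finite_measure_Union sets.sets_Collect_conj S_sets T_sets) auto
  finally have sum1:
    "\<P>(\<omega> in M. S \<omega> i = 0 \<bar> T \<omega> = \<gamma>) + \<P>(\<omega> in M. S \<omega> i = 1 \<bar> T \<omega> = \<gamma>) = 1"
    using T pos by (simp add: cond_prob_def add_divide_distrib[symmetric])
  from allocations_cases[OF \<gamma> i] signals_cases[OF s i] show ?thesis
    using sum1 true_positive[OF \<gamma> pos i] true_negative[OF \<gamma> pos i]
    by (auto simp: box_likelihood_def)
qed

text \<open>Both sides vanish when \<open>\<pi> \<gamma> = 0\<close>; otherwise the event \<open>S = s\<close> is the intersection of the
  coordinate events, which are independent under the conditional measure given \<open>T = \<gamma>\<close>.\<close>

lemma joint_prob_eq:
  assumes \<gamma>: "\<gamma> \<in> allocations n k" and s: "s \<in> signals n"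
  shows "\<P>(\<omega> in M. S \<omega> = s \<and> T \<omega> = \<gamma>) = \<pi> \<gamma> * signal_pmf n a b s \<gamma>"
proof (cases "\<pi> \<gamma> > 0")
  case False
  have "\<P>(\<omega> in M. S \<omega> = s \<and> T \<omega> = \<gamma>) \<le> \<P>(\<omega> in M. T \<omega> = \<gamma>)"
    by (intro finite_measure_mono T_sets) auto
  moreover have "\<P>(\<omega> in M. T \<omega> = \<gamma>) = \<pi> \<gamma>"
    using T_distribution[OF \<gamma>] .
  ultimately show ?thesis
    using False measure_nonneg[of M "{\<omega> \<in> space M. T \<omega> = \<gamma>}"]
    by (simp add: measure_le_0_iff)
next
  case pos: True
  define B where "B = {\<omega> \<in> space M. T \<omega> = \<gamma>}"
  have B: "B \<in> events" "prob B = \<pi> \<gamma>"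
    using T_sets T_distribution[OF \<gamma>] by (auto simp: B_def)
  have emB: "emeasure M B \<noteq> 0" "emeasure M B \<noteq> \<infinity>"
    using pos B by (auto simp: emeasure_eq_measure)
  interpret U: prob_space "uniform_measure M B"
    using emB by (rule prob_space_uniform_measure)
  have U_eq: "measure (uniform_measure M B) {\<omega> \<in> space M. P (S \<omega>)} =
      \<P>(\<omega> in M. P (S \<omega>) \<bar> T \<omega> = \<gamma>)" for P
  proof -
    have "B \<inter> {\<omega> \<in> space M. P (S \<omega>)} = {\<omega> \<in> space M. P (S \<omega>) \<and> T \<omega> = \<gamma>}"
      by (auto simp: B_def)
    then show ?thesis
      using measure_uniform_measure[OF emB S_sets[of P]]
      by (simp add: cond_prob_def B_def)
  qed
  show ?thesis
  \<comment> \<open>The product rule for independent events needs a nonempty index set; without boxes there is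
    only one signal.\<close>
  proof (cases "n = 0")
    case True
    have "S \<omega> = s" if "\<omega> \<in> space M" for \<omega>
      using measurable_space[OF S_measurable that] s True by (simp add: signals_def)
    then have "{\<omega> \<in> space M. S \<omega> = s \<and> T \<omega> = \<gamma>} = B"
      by (auto simp: B_def)
    then show ?thesis
      using B True by (simp add: signal_pmf_def)
  next
    case False
    have ext: "S \<omega> = s \<longleftrightarrow> (\<forall>i\<in>{1..n}. S \<omega> i = s i)" if "\<omega> \<in> space M" for \<omega>
      using measurable_space[OF S_measurable that] s
      by (auto simp: signals_def intro: PiE_ext)
    have "\<P>(\<omega> in M. S \<omega> = s \<bar> T \<omega> = \<gamma>) =
        measure (uniform_measure M B) {\<omega> \<in> space M. S \<omega> = s}"
      by (rule U_eq[symmetric])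
    also have "{\<omega> \<in> space M. S \<omega> = s} =
        (\<Inter>i\<in>{1..n}. (\<lambda>\<omega>. S \<omega> i) -` {s i} \<inter> space (uniform_measure M B))"
      using False ext by auto
    also have "measure (uniform_measure M B) \<dots> =
        (\<Prod>i=1..n. measure (uniform_measure M B)
          ((\<lambda>\<omega>. S \<omega> i) -` {s i} \<inter> space (uniform_measure M B)))"
      using S_cond_indep[OF \<gamma> pos] False signals_cases[OF s]
      by (intro U.indep_varsD[where M' = "\<lambda>_. count_space {0, 1}"]) (auto simp: B_def)
    also have "\<dots> = (\<Prod>i=1..n. \<P>(\<omega> in M. S \<omega> i = s i \<bar> T \<omega> = \<gamma>))"
    proof (rule prod.cong[OF refl])
      fix i assume "i \<in> {1..n}"
      have "(\<lambda>\<omega>. S \<omega> i) -` {s i} \<inter> space (uniform_measure M B) = {\<omega> \<in> space M. S \<omega> i = s i}"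
        by auto
      then show "measure (uniform_measure M B)
          ((\<lambda>\<omega>. S \<omega> i) -` {s i} \<inter> space (uniform_measure M B)) =
          \<P>(\<omega> in M. S \<omega> i = s i \<bar> T \<omega> = \<gamma>)"
        using U_eq[of "\<lambda>t. t i = s i"] by simp
    qed
    also have "\<dots> = signal_pmf n a b s \<gamma>"
      unfolding signal_pmf_eq_prod[OF \<gamma>]
      by (intro prod.cong refl cond_prob_signal_coordinate[OF \<gamma> pos s])
    finally show ?thesis
      using B pos by (simp add: cond_prob_def B_def field_simps)
  qed
qed

text \<open>The success event splits into the disjoint events \<open>S = s\<close>, \<open>T = \<gamma>\<close> with \<open>\<gamma>\<close> favourable for
  the set tagged at \<open>s\<close>, so the rule enters each summand through its value at one signal only.\<close>

lemma success_prob_eq: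
  "\<P>(\<omega> in M. \<forall>i\<in>\<delta> (S \<omega>). T \<omega> i = 1) = (\<Sum>s\<in>signals n. joint_weight n k a b \<pi> s (\<delta> s))"
proof -
  define I where
    "I = Sigma (signals n) (\<lambda>s. {\<gamma> \<in> allocations n k. \<forall>i\<in>\<delta> s. \<gamma> i = 1})"
  have "finite I"
    unfolding I_def by (intro finite_SigmaI finite_signals) (simp add: finite_allocations)
  have "{\<omega> \<in> space M. \<forall>i\<in>\<delta> (S \<omega>). T \<omega> i = 1} =
      (\<Union>(s, \<gamma>)\<in>I. {\<omega> \<in> space M. S \<omega> = s \<and> T \<omega> = \<gamma>})"
    using measurable_space[OF S_measurable] measurable_space[OF T_measurable]
    by (auto simp: I_def)
  then have "\<P>(\<omega> in M. \<forall>i\<in>\<delta> (S \<omega>). T \<omega> i = 1) =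
      prob (\<Union>(s, \<gamma>)\<in>I. {\<omega> \<in> space M. S \<omega> = s \<and> T \<omega> = \<gamma>})"
    by simp
  also have "\<dots> = (\<Sum>(s, \<gamma>)\<in>I. \<P>(\<omega> in M. S \<omega> = s \<and> T \<omega> = \<gamma>))"
    using \<open>finite I\<close>
    by (subst finite_measure_finite_Union)
      (auto simp: disjoint_family_on_def case_prod_beta
        intro!: sets.sets_Collect_conj S_sets T_sets)
  also have "\<dots> = (\<Sum>(s, \<gamma>)\<in>I. \<pi> \<gamma> * signal_pmf n a b s \<gamma>)"
    by (intro sum.cong refl) (auto simp: I_def joint_prob_eq)
  also have "\<dots> = (\<Sum>s\<in>signals n. joint_weight n k a b \<pi> s (\<delta> s))"
    unfolding I_def joint_weight_def
    by (subst sum.Sigma) (auto simp: finite_signals finite_allocations)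
  finally show ?thesis .
qed

lemma expected_reward_eq_prob:
  "expected_reward M T S C \<delta> = C * \<P>(\<omega> in M. \<forall>i\<in>\<delta> (S \<omega>). T \<omega> i = 1)"
proof -
  define A where "A = {\<omega> \<in> space M. \<forall>i\<in>\<delta> (S \<omega>). T \<omega> i = 1}"
  have "expected_reward M T S C \<delta> = (\<integral>\<omega>. indicator A \<omega> * C \<partial>M)"
    unfolding expected_reward_def
    by (intro Bochner_Integration.integral_cong) (auto simp: A_def indicator_def)
  also have "\<dots> = C * prob (A \<inter> space M)"
    by simp
  also have "A \<inter> space M = A"
    by (auto simp: A_def)
  finally show ?thesis
    by (simp add: A_def)
qed

lemma expected_reward_eq_sum:
  "expected_reward M T S C \<delta> = C * (\<Sum>s\<in>signals n. joint_weight n k a b \<pi> s (\<delta> s))"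
  by (simp only: expected_reward_eq_prob success_prob_eq)

lemma pointwise_arg_max_optimal:
  assumes C: "C \<ge> 0"
    and opt: "\<And>s. s \<in> signals n \<Longrightarrow>
      is_arg_max (joint_weight n k a b \<pi> s) (\<lambda>\<eta>. \<eta> \<in> box_sets n m) (\<delta> s)"
  shows "is_arg_max (expected_reward M T S C) (\<lambda>\<delta>. \<delta> \<in> signals n \<rightarrow> box_sets n m) \<delta>"
    and "expected_reward M T S C \<delta> =
      C * (\<Sum>s\<in>signals n. MAX \<eta>\<in>box_sets n m. joint_weight n k a b \<pi> s \<eta>)"
proof -
  have mem: "\<delta> \<in> signals n \<rightarrow> box_sets n m"
    using opt by (auto simp: is_arg_max_linorder)
  have "expected_reward M T S C \<delta>' \<le> expected_reward M T S C \<delta>"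
    if "\<delta>' \<in> signals n \<rightarrow> box_sets n m" for \<delta>'
    unfolding expected_reward_eq_sum using opt that
    by (intro mult_left_mono[OF _ C] sum_mono) (auto simp: is_arg_max_linorder)
  with mem show "is_arg_max (expected_reward M T S C) (\<lambda>\<delta>. \<delta> \<in> signals n \<rightarrow> box_sets n m) \<delta>"
    by (simp add: is_arg_max_linorder)
  have "joint_weight n k a b \<pi> s (\<delta> s) = (MAX \<eta>\<in>box_sets n m. joint_weight n k a b \<pi> s \<eta>)"
    if "s \<in> signals n" for s
    using opt[OF that]
    by (intro Max_eqI[symmetric]) (auto simp: is_arg_max_linorder finite_box_sets)
  then show "expected_reward M T S C \<delta> =
      C * (\<Sum>s\<in>signals n. MAX \<eta>\<in>box_sets n m. joint_weight n k a b \<pi> s \<eta>)"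
    by (simp add: expected_reward_eq_sum)
qed

end

section \<open>Exchanging two boxes\<close>

lemma allocations_comp_transpose:
  assumes \<gamma>: "\<gamma> \<in> allocations n k" and ij: "i \<in> {1..n}" "j \<in> {1..n}"
  shows "\<gamma> \<circ> Transposition.transpose i j \<in> allocations n k"
proof -
  have perm: "Transposition.transpose i j permutes {1..n}"
    using ij by (rule permutes_swap_id)
  have "(\<Sum>l=1..n. (\<gamma> \<circ> Transposition.transpose i j) l) = (\<Sum>l=1..n. \<gamma> l)"
    by (rule sum.permute[OF perm, symmetric])
  moreover have "\<gamma> \<circ> Transposition.transpose i j \<in> {1..n} \<rightarrow>\<^sub>E {0, 1}"
  proof (rule PiE_I)
    fix l assume "l \<in> {1..n}"
    then have "Transposition.transpose i j l \<in> {1..n}"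
      using permutes_in_image[OF perm] by blast
    from allocations_cases[OF \<gamma> this] show "(\<gamma> \<circ> Transposition.transpose i j) l \<in> {0, 1}"
      by simp
  next
    fix l assume "l \<notin> {1..n}"
    moreover from this have "Transposition.transpose i j l = l"
      by (rule permutes_not_in[OF perm])
    moreover have "\<gamma> \<in> {1..n} \<rightarrow>\<^sub>E {0, 1}"
      using \<gamma> by (simp add: allocations_def)
    ultimately show "(\<gamma> \<circ> Transposition.transpose i j) l = undefined"
      using PiE_arb[of \<gamma> "{1..n}" "\<lambda>_. {0, 1}" l] by simp
  qed
  ultimately show ?thesis
    using \<gamma> by (simp add: allocations_def)
qed

text \<open>Moving an object from \<open>i\<close> to \<open>j\<close> changes the likelihood only through the factors of these two
  boxes, and replaces two wrong test results by two right ones if \<open>s i = 0\<close> and \<open>s j = 1\<close>. For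
  equal signals the two factors trade places.\<close>

lemma signal_pmf_swap_le:
  assumes \<gamma>: "\<gamma> \<in> allocations n k" and s: "s \<in> signals n"
    and ij: "i \<in> {1..n}" "j \<in> {1..n}" and g: "\<gamma> i = 1" "\<gamma> j = 0"
    and le: "s i \<le> s j"
    and hom: "a j = a i" "b j = b i"
    and a: "\<And>l. l \<in> {1..n} \<Longrightarrow> a l \<in> {1/2..1}"
    and b: "\<And>l. l \<in> {1..n} \<Longrightarrow> b l \<in> {1/2..1}"
  shows "signal_pmf n a b s \<gamma> \<le> signal_pmf n a b s (\<gamma> \<circ> Transposition.transpose i j)"
proof -
  let ?f = "\<lambda>\<gamma> l. box_likelihood (a l) (b l) (\<gamma> l) (s l)"
  let ?g = "\<gamma> \<circ> Transposition.transpose i j"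
  have ne: "i \<noteq> j"
    using g by auto
  have split: "(\<Prod>l=1..n. F l) = F i * F j * (\<Prod>l\<in>{1..n} - {i, j}. F l)" for F :: "nat \<Rightarrow> real"
  proof -
    have "(\<Prod>l=1..n. F l) = (\<Prod>l\<in>{i, j}. F l) * (\<Prod>l\<in>{1..n} - {i, j}. F l)"
      using ij by (subst mult.commute, intro prod.subset_diff) auto
    then show ?thesis
      using ne by simp
  qed
  have rest: "(\<Prod>l\<in>{1..n} - {i, j}. ?f ?g l) = (\<Prod>l\<in>{1..n} - {i, j}. ?f \<gamma> l)"
    by (intro prod.cong) (auto simp: Transposition.transpose_def)
  have nonneg: "(\<Prod>l\<in>{1..n} - {i, j}. ?f \<gamma> l) \<ge> 0"
  proof (intro prod_nonneg ballI)
    fix l assume "l \<in> {1..n} - {i, j}"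
    then have "l \<in> {1..n}" by simp
    from a[OF this] b[OF this] show "?f \<gamma> l \<ge> 0"
      by (auto simp: box_likelihood_def)
  qed
  have ab: "(1 - a i) * (1 - b i) \<le> a i * b i"
    using a[OF ij(1)] b[OF ij(1)] by (intro mult_mono) auto
  have "?f \<gamma> i * ?f \<gamma> j \<le> ?f ?g i * ?f ?g j"
    using signals_cases[OF s ij(1)] signals_cases[OF s ij(2)] le ab g ne
    by (auto simp: box_likelihood_def hom mult.commute)
  then show ?thesis
    unfolding signal_pmf_eq_prod[OF \<gamma>]
      signal_pmf_eq_prod[OF allocations_comp_transpose[OF \<gamma> ij]] split rest
    by (intro mult_right_mono nonneg)
qed

text \<open>Compare the two sums along a bijection from the allocations favourable for \<open>\<eta>\<close> to those
  favourable for the exchanged set. It fixes the allocations that have objects in both \<open>i\<close> and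
  \<open>j\<close>, as these are favourable for both sets, and interchanges the two boxes in the others. The
  prior weight is preserved, and the likelihood does not decrease.\<close>

lemma joint_weight_exchange:
  assumes s: "s \<in> signals n"
    and ij: "i \<in> {1..n}" "j \<in> {1..n}" and \<eta>: "i \<in> \<eta>" "j \<notin> \<eta>"
    and le: "s i \<le> s j"
    and hom: "a j = a i" "b j = b i"
    and a: "\<And>l. l \<in> {1..n} \<Longrightarrow> a l \<in> {1/2..1}"
    and b: "\<And>l. l \<in> {1..n} \<Longrightarrow> b l \<in> {1/2..1}"
    and \<pi>: "\<And>\<gamma>. \<gamma> \<in> allocations n k \<Longrightarrow> \<pi> \<gamma> \<ge> 0"
      "\<And>\<gamma>. \<gamma> \<in> allocations n k \<Longrightarrow> \<pi> (\<gamma> \<circ> Transposition.transpose i j) = \<pi> \<gamma>"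
  shows "joint_weight n k a b \<pi> s \<eta> \<le> joint_weight n k a b \<pi> s (insert j (\<eta> - {i}))"
proof -
  let ?\<eta>' = "insert j (\<eta> - {i})"
  let ?A = "{\<gamma> \<in> allocations n k. \<forall>l\<in>\<eta>. \<gamma> l = 1}"
  let ?B = "{\<gamma> \<in> allocations n k. \<forall>l\<in>?\<eta>'. \<gamma> l = 1}"
  let ?w = "\<lambda>\<gamma>. \<pi> \<gamma> * signal_pmf n a b s \<gamma>"
  define swap where "swap = (\<lambda>\<gamma>::nat \<Rightarrow> nat. \<gamma> \<circ> Transposition.transpose i j)"
  define f where "f = (\<lambda>\<gamma>. if \<gamma> j = 1 then \<gamma> else swap \<gamma>)"
  define g where "g = (\<lambda>\<gamma>. if \<gamma> i = 1 then \<gamma> else swap \<gamma>)"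
  have swap_in: "swap \<gamma> \<in> allocations n k" if "\<gamma> \<in> allocations n k" for \<gamma>
    unfolding swap_def using that ij by (rule allocations_comp_transpose)
  have swap_simps [simp]: "swap \<gamma> i = \<gamma> j" "swap \<gamma> j = \<gamma> i" "swap (swap \<gamma>) = \<gamma>" for \<gamma>
    by (auto simp: swap_def comp_assoc)
  have swap_other: "swap \<gamma> l = \<gamma> l" if "l \<noteq> i" "l \<noteq> j" for \<gamma> l
    using that by (simp add: swap_def Transposition.transpose_def)
  have f: "f \<gamma> \<in> ?B \<and> g (f \<gamma>) = \<gamma>" if "\<gamma> \<in> ?A" for \<gamma>
  proof -
    have "f \<gamma> l = 1" if "l \<in> insert j (\<eta> - {i})" for l
      using \<open>\<gamma> \<in> ?A\<close> \<eta> that by (cases "l = i"; cases "l = j") (auto simp: f_def swap_other)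
    then show ?thesis
      using that \<eta> swap_in by (auto simp: f_def g_def)
  qed
  have g: "g \<gamma> \<in> ?A \<and> f (g \<gamma>) = \<gamma>" if "\<gamma> \<in> ?B" for \<gamma>
  proof -
    have "g \<gamma> l = 1" if "l \<in> \<eta>" for l
      using \<open>\<gamma> \<in> ?B\<close> \<eta> that by (cases "l = i"; cases "l = j") (auto simp: g_def swap_other)
    then show ?thesis
      using that swap_in by (auto simp: f_def g_def)
  qed
  have "joint_weight n k a b \<pi> s \<eta> = (\<Sum>\<gamma>\<in>?A. ?w \<gamma>)"
    by (simp add: joint_weight_def)
  also have "\<dots> \<le> (\<Sum>\<gamma>\<in>?A. ?w (f \<gamma>))"
  proof (rule sum_mono)
    fix \<gamma> assume A: "\<gamma> \<in> ?A"
    then have \<gamma>: "\<gamma> \<in> allocations n k" and "\<gamma> i = 1"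
      using \<eta> by auto
    show "?w \<gamma> \<le> ?w (f \<gamma>)"
    proof (cases "\<gamma> j = 1")
      case False
      then have "\<gamma> j = 0"
        using allocations_cases[OF \<gamma> ij(2)] by simp
      then have "signal_pmf n a b s \<gamma> \<le> signal_pmf n a b s (swap \<gamma>)"
        unfolding swap_def using \<gamma> \<open>\<gamma> i = 1\<close> s ij le hom a b by (intro signal_pmf_swap_le) auto
      then show ?thesis
        using False \<pi>[OF \<gamma>] by (simp add: f_def swap_def mult_left_mono)
    qed (simp add: f_def)
  qed
  also have "\<dots> = (\<Sum>\<gamma>\<in>?B. ?w \<gamma>)"
    using f g by (intro sum.reindex_bij_witness[of _ g f]) blast+
  also have "\<dots> = joint_weight n k a b \<pi> s ?\<eta>'"
    by (simp add: joint_weight_def)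
  finally show ?thesis .
qed

text \<open>As long as a competitor \<open>\<eta>\<close> differs from \<open>\<theta>\<close>, equality of cardinalities provides some
  \<open>i \<in> \<eta> - \<theta>\<close> and \<open>j \<in> \<theta> - \<eta>\<close>; exchanging them does not decrease the weight and brings
  \<open>\<eta>\<close> closer to \<open>\<theta>\<close>.\<close>

lemma top_set_arg_max:
  assumes s: "s \<in> signals n" and top: "\<theta> \<in> box_sets n m"
    and upper: "\<And>i j. i \<in> {1..n} - \<theta> \<Longrightarrow> j \<in> \<theta> \<Longrightarrow> s i \<le> s j"
    and hom: "\<And>i. i \<in> {1..n} \<Longrightarrow> a i = a0" "\<And>i. i \<in> {1..n} \<Longrightarrow> b i = b0"
    and ab: "a0 \<in> {1/2..1}" "b0 \<in> {1/2..1}"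
    and \<pi>: "\<And>\<gamma>. \<gamma> \<in> allocations n k \<Longrightarrow> \<pi> \<gamma> = c" "c \<ge> 0"
  shows "is_arg_max (joint_weight n k a b \<pi> s) (\<lambda>\<eta>. \<eta> \<in> box_sets n m) \<theta>"
proof -
  have \<theta>: "\<theta> \<subseteq> {1..n}" "finite \<theta>" "card \<theta> = m"
    using top finite_subset by (auto simp: box_sets_def)
  have "joint_weight n k a b \<pi> s \<eta> \<le> joint_weight n k a b \<pi> s \<theta>" if "\<eta> \<in> box_sets n m" for \<eta>
    using that
  proof (induction "card (\<eta> - \<theta>)" arbitrary: \<eta> rule: less_induct)
    case less
    have \<eta>: "\<eta> \<subseteq> {1..n}" "finite \<eta>" "card \<eta> = m"
      using less.prems finite_subset by (auto simp: box_sets_def)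
    show ?case
    proof (cases "\<eta> = \<theta>")
      case False
      have "\<not> \<eta> \<subseteq> \<theta>" "\<not> \<theta> \<subseteq> \<eta>"
        using False card_subset_eq \<eta> \<theta> by metis+
      then obtain i j where i: "i \<in> \<eta>" "i \<notin> \<theta>" and j: "j \<in> \<theta>" "j \<notin> \<eta>"
        by blast
      have ij: "i \<in> {1..n}" "j \<in> {1..n}"
        using i j \<eta> \<theta> by auto
      let ?\<eta>' = "insert j (\<eta> - {i})"
      have "?\<eta>' - \<theta> = (\<eta> - \<theta>) - {i}"
        using j by auto
      then have dec: "card (?\<eta>' - \<theta>) < card (\<eta> - \<theta>)"
        using i \<eta> by (metis DiffI card_Diff1_less finite_Diff)
      have "card ?\<eta>' = m"
        using i j \<eta> card_Suc_Diff1[of \<eta> i] by simp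
      then have mem: "?\<eta>' \<in> box_sets n m"
        using \<eta> ij by (auto simp: box_sets_def)
      have "joint_weight n k a b \<pi> s \<eta> \<le> joint_weight n k a b \<pi> s ?\<eta>'"
      proof (rule joint_weight_exchange[OF s ij i(1) j(2)])
        show "s i \<le> s j"
          using upper i j ij by blast
        show "a j = a i" "b j = b i"
          using hom ij by simp_all
        show "a l \<in> {1/2..1}" "b l \<in> {1/2..1}" if "l \<in> {1..n}" for l
          using hom that ab by simp_all
        show "\<pi> \<gamma> \<ge> 0" "\<pi> (\<gamma> \<circ> Transposition.transpose i j) = \<pi> \<gamma>" if "\<gamma> \<in> allocations n k" for \<gamma>
          using \<pi> that allocations_comp_transpose[OF that ij] by simp_all
      qed
      also have "\<dots> \<le> joint_weight n k a b \<pi> s \<theta>"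
        by (rule less.hyps[OF dec mem])
      finally show ?thesis .
    qed simp
  qed
  with top show ?thesis
    by (simp add: is_arg_max_linorder)
qed

lemma card_positive_signals:
  assumes "s \<in> signals n"
  shows "card {i\<in>{1..n}. s i = 1} + (\<Sum>i=1..n. 1 - s i) = n"
proof -
  have "card {i\<in>{1..n}. s i = 1} = (\<Sum>i=1..n. if s i = 1 then 1 else 0)"
    by (subst sum.If_cases) (auto intro: arg_cong[where f = card])
  also have "\<dots> + (\<Sum>i=1..n. 1 - s i) = (\<Sum>i=1..n. (if s i = 1 then 1 else 0) + (1 - s i))"
    by (simp add: sum.distrib)
  also have "\<dots> = (\<Sum>i=1..n. 1)"
  proof (rule sum.cong[OF refl])
    fix i assume "i \<in> {1..n}"
    from signals_cases[OF assms this] show "(if s i = 1 then 1 else 0) + (1 - s i) = 1"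
      by auto
  qed
  finally show ?thesis
    by simp
qed

theorem mainTheorem6:
  fixes M :: "'w measure"
    and n m k :: nat
    and a b :: "nat \<Rightarrow> real"
    and \<pi> :: "(nat \<Rightarrow> nat) \<Rightarrow> real"
    and T S :: "'w \<Rightarrow> nat \<Rightarrow> nat"
    and C :: real
  assumes "1 \<le> m" and "m \<le> k" and "k \<le> n"
    and "\<And>i. i \<in> {1..n} \<Longrightarrow> a i \<in> {1/2..1}"
    and "\<And>i. i \<in> {1..n} \<Longrightarrow> b i \<in> {1/2..1}"
    and "test_and_find M n k a b \<pi> T S"
    and "C > 0"
  shows
    "(\<forall>\<delta>. \<delta> \<in> signals n \<rightarrow> box_sets n m \<longrightarrow>
        expected_reward M T S C \<delta> = C * \<P>(\<omega> in M. \<forall>i\<in>\<delta> (S \<omega>). T \<omega> i = 1))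
     \<and> (\<forall>\<eta>opt. (\<forall>s\<in>signals n.
            is_arg_max (joint_weight n k a b \<pi> s) (\<lambda>\<eta>. \<eta> \<in> box_sets n m) (\<eta>opt s)) \<longrightarrow>
          is_arg_max (expected_reward M T S C) (\<lambda>\<delta>. \<delta> \<in> signals n \<rightarrow> box_sets n m) \<eta>opt
          \<and> expected_reward M T S C \<eta>opt =
              C * (\<Sum>s\<in>signals n. MAX \<eta>\<in>box_sets n m. joint_weight n k a b \<pi> s \<eta>))
     \<and> (\<forall>a0 b0 :: real.
          (\<forall>\<gamma>\<in>allocations n k. \<pi> \<gamma> = 1 / real (card (allocations n k))) \<longrightarrow>
          (\<forall>i\<in>{1..n}. a i = a0 \<and> b i = b0) \<longrightarrow>
          1/2 \<le> a0 \<longrightarrow> a0 < 1 \<longrightarrow> 1/2 \<le> b0 \<longrightarrow> b0 < 1 \<longrightarrow> (a0 \<noteq> 1/2 \<or> b0 \<noteq> 1/2) \<longrightarrow>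
          (\<forall>s\<in>signals n. \<forall>x. x = (\<Sum>i=1..n. 1 - s i) \<longrightarrow>
            (n - x \<ge> m \<longrightarrow>
              (\<forall>\<eta>. \<eta> \<subseteq> {i\<in>{1..n}. s i = 1} \<longrightarrow> card \<eta> = m \<longrightarrow>
                is_arg_max (joint_weight n k a b \<pi> s) (\<lambda>\<eta>. \<eta> \<in> box_sets n m) \<eta>)) \<and>
            (n - x < m \<longrightarrow>
              (\<forall>Z. Z \<subseteq> {i\<in>{1..n}. s i = 0} \<longrightarrow> card Z = m + x - n \<longrightarrow>
                is_arg_max (joint_weight n k a b \<pi> s) (\<lambda>\<eta>. \<eta> \<in> box_sets n m)
                  ({i\<in>{1..n}. s i = 1} \<union> Z)))))"
proof (intro conjI allI impI ballI)
  interpret test_and_find M n k a b \<pi> T S by fact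
  show "expected_reward M T S C \<delta> = C * \<P>(\<omega> in M. \<forall>i\<in>\<delta> (S \<omega>). T \<omega> i = 1)" for \<delta>
    by (rule expected_reward_eq_prob)
  have C: "C \<ge> 0"
    using \<open>C > 0\<close> by simp
  fix \<eta>opt
  assume opt: "\<forall>s\<in>signals n.
    is_arg_max (joint_weight n k a b \<pi> s) (\<lambda>\<eta>. \<eta> \<in> box_sets n m) (\<eta>opt s)"
  show "is_arg_max (expected_reward M T S C) (\<lambda>\<delta>. \<delta> \<in> signals n \<rightarrow> box_sets n m) \<eta>opt"
    by (rule pointwise_arg_max_optimal(1)[OF C opt[rule_format]])
  show "expected_reward M T S C \<eta>opt =
      C * (\<Sum>s\<in>signals n. MAX \<eta>\<in>box_sets n m. joint_weight n k a b \<pi> s \<eta>)"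
    by (rule pointwise_arg_max_optimal(2)[OF C opt[rule_format]])
next
  fix a0 b0 :: real and s :: "nat \<Rightarrow> nat" and x :: nat and \<eta> :: "nat set"
  assume \<pi>: "\<forall>\<gamma>\<in>allocations n k. \<pi> \<gamma> = 1 / real (card (allocations n k))"
    and hom: "\<forall>i\<in>{1..n}. a i = a0 \<and> b i = b0"
    and ab: "1/2 \<le> a0" "a0 < 1" "1/2 \<le> b0" "b0 < 1"
    and s: "s \<in> signals n" and \<eta>: "\<eta> \<subseteq> {i\<in>{1..n}. s i = 1}" "card \<eta> = m"
  have mem: "\<eta> \<in> box_sets n m"
    using \<eta> by (auto simp: box_sets_def)
  have "s i \<le> s j" if "i \<in> {1..n} - \<eta>" "j \<in> \<eta>" for i j
    using signals_cases[OF s, of i] that \<eta> by auto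
  then show "is_arg_max (joint_weight n k a b \<pi> s) (\<lambda>\<eta>. \<eta> \<in> box_sets n m) \<eta>"
  proof (rule top_set_arg_max[OF s mem])
    show "a i = a0" "b i = b0" if "i \<in> {1..n}" for i
      using hom that by simp_all
    show "a0 \<in> {1/2..1}" "b0 \<in> {1/2..1}"
      using ab by simp_all
    show "\<pi> \<gamma> = 1 / real (card (allocations n k))" if "\<gamma> \<in> allocations n k" for \<gamma>
      using \<pi> that by blast
  qed simp_all
next
  fix a0 b0 :: real and s :: "nat \<Rightarrow> nat" and x :: nat and Z :: "nat set"
  assume \<pi>: "\<forall>\<gamma>\<in>allocations n k. \<pi> \<gamma> = 1 / real (card (allocations n k))"
    and hom: "\<forall>i\<in>{1..n}. a i = a0 \<and> b i = b0"
    and ab: "1/2 \<le> a0" "a0 < 1" "1/2 \<le> b0" "b0 < 1"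
    and s: "s \<in> signals n" and x: "x = (\<Sum>i=1..n. 1 - s i)" "n - x < m"
    and Z: "Z \<subseteq> {i\<in>{1..n}. s i = 0}" "card Z = m + x - n"
  let ?\<theta> = "{i\<in>{1..n}. s i = 1} \<union> Z"
  have "card ?\<theta> = card {i\<in>{1..n}. s i = 1} + card Z"
    using Z finite_subset[OF Z(1)] by (intro card_Un_disjoint) auto
  also have "\<dots> = m"
    using card_positive_signals[OF s] x Z(2) by simp
  finally have mem: "?\<theta> \<in> box_sets n m"
    using Z by (auto simp: box_sets_def)
  have "s i \<le> s j" if "i \<in> {1..n} - ?\<theta>" "j \<in> ?\<theta>" for i j
    using signals_cases[OF s, of i] that by auto
  then show "is_arg_max (joint_weight n k a b \<pi> s) (\<lambda>\<eta>. \<eta> \<in> box_sets n m) ?\<theta>"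
  proof (rule top_set_arg_max[OF s mem])
    show "a i = a0" "b i = b0" if "i \<in> {1..n}" for i
      using hom that by simp_all
    show "a0 \<in> {1/2..1}" "b0 \<in> {1/2..1}"
      using ab by simp_all
    show "\<pi> \<gamma> = 1 / real (card (allocations n k))" if "\<gamma> \<in> allocations n k" for \<gamma>
      using \<pi> that by blast
  qed simp_all
qed

end
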